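(* The partial order $\mathbf{Peq}$ of punctual degrees is a lattice, i.e. any two elements of $\mathbf{Peq}$ have a least upper bound and a greatest lower bound in $\mathbf{Peq}$.
   Context: A punctual equivalence relation is a primitive recursive equivalence relation with domain $\omega$ having infinitely many equivalence classes. For equivalence relations $R,S$ on $\omega$, $R\leq_{pr} S$ means that there is a primitive recursive function $f:\omega\to\omega$ such that for all $x,y\in\omega$, $x\mathrel{R}y \Leftrightarrow f(x)\mathrel{S}f(y)$. Write $R\equiv_{pr}S$ if $R\leq_{pr}S$ and $S\leq_{pr}R$. $\mathbf{Peq}$ is the partial order of $\equiv_{pr}$-classes (punctual degrees) of punctual equivalence relations, ordered by the order induced by $\leq_{pr}$. *)

theory Defs
  imports "HOL-Algebra.Lattice"
begin

(* "primrec_fun n f": f, read as an n-ary function on the lists of length n, is primitive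
   recursive. The values of f on lists of any other length carry no meaning. *)
inductive primrec_fun :: "nat \<Rightarrow> (nat list \<Rightarrow> nat) \<Rightarrow> bool" where
  zero: "primrec_fun n (\<lambda>xs. 0)"
| succ: "primrec_fun 1 (\<lambda>xs. Suc (xs ! 0))"
| proj: "i < n \<Longrightarrow> primrec_fun n (\<lambda>xs. xs ! i)"
| comp: "primrec_fun (length gs) f \<Longrightarrow> \<forall>g \<in> set gs. primrec_fun n g \<Longrightarrow>
    primrec_fun n (\<lambda>xs. f (map (\<lambda>g. g xs) gs))"
| prec: "primrec_fun n f \<Longrightarrow> primrec_fun (Suc (Suc n)) g \<Longrightarrow>
    primrec_fun (Suc n)
      (\<lambda>xs. rec_nat (f (tl xs)) (\<lambda>y r. g (y # r # tl xs)) (hd xs))"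

definition prim_rec1 :: "(nat \<Rightarrow> nat) \<Rightarrow> bool" where
  "prim_rec1 f \<longleftrightarrow> (\<exists>F. primrec_fun 1 F \<and> (\<forall>x. f x = F [x]))"

definition prim_rec_rel :: "(nat \<times> nat) set \<Rightarrow> bool" where
  "prim_rec_rel R \<longleftrightarrow>
    (\<exists>F. primrec_fun 2 F \<and> (\<forall>x y. F [x, y] = (if (x, y) \<in> R then 1 else 0)))"

definition punctual_eqrels :: "(nat \<times> nat) set set" where
  "punctual_eqrels = {R. equiv UNIV R \<and> prim_rec_rel R \<and> infinite (UNIV // R)}"

definition pr_reducible :: "(nat \<times> nat) set \<Rightarrow> (nat \<times> nat) set \<Rightarrow> bool"
    (infix "\<le>pr" 50) where
  "R \<le>pr S \<longleftrightarrow>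
    (\<exists>f. prim_rec1 f \<and> (\<forall>x y. (x, y) \<in> R \<longleftrightarrow> (f x, f y) \<in> S))"

definition pr_equiv :: "((nat \<times> nat) set \<times> (nat \<times> nat) set) set" where
  "pr_equiv = {(R, S). R \<in> punctual_eqrels \<and> S \<in> punctual_eqrels \<and> R \<le>pr S \<and> S \<le>pr R}"

definition Peq :: "(nat \<times> nat) set set gorder" where
  "Peq = \<lparr>carrier = punctual_eqrels // pr_equiv, eq = (=),
          le = (\<lambda>a b. \<exists>R \<in> a. \<exists>S \<in> b. R \<le>pr S)\<rparr>"

end

theory Submission
  imports Defs
begin

text \<open>
  A punctual equivalence relation is determined, up to punctual bi-reducibility, by how fast its
  classes show up. Let \<open>class_count R x\<close> be the number of \<open>R\<close>-classes that meet \<open>{0, \<dots>, x}\<close>. Then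
  \<open>R \<le>pr S\<close> holds exactly when some primitive recursive \<open>h\<close> satisfies
  \<open>class_count R x \<le> class_count S (h x)\<close> for all \<open>x\<close> (\<open>pr_reducible_iff_class_count\<close>). If \<open>f\<close>
  reduces \<open>R\<close> to \<open>S\<close>, then \<open>h x = max {f 0, \<dots>, f x}\<close> works, because \<open>f\<close> is injective on classes.
  Conversely, given \<open>h\<close>, an element of the \<open>k\<close>-th \<open>R\<close>-class (in order of first appearance) is sent
  to the first element of the \<open>k\<close>-th \<open>S\<close>-class; the bound \<open>h\<close> is what makes the search for that
  element primitive recursive.

  The counting functions that arise are the primitive recursive, monotone, unbounded functions
  that start at 1 and never grow by more than 1 in a step: for such an \<open>m\<close>, the relation
  \<open>m x = m y\<close> is a punctual equivalence relation with counting function \<open>m\<close>. These functions are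
  closed under pointwise maximum and minimum, and the criterion above shows that the maximum and
  the minimum of two counting functions give a least upper bound and a greatest lower bound: a
  common bounding function for two reductions is the pointwise maximum of the two given ones.
\<close>

section \<open>Closure properties of primitive recursive functions\<close>

text \<open>
  The values of a function on lists of the wrong length are irrelevant; identifying functions that
  agree on lists of length \<open>n\<close> makes the closure rules applicable up to ordinary rewriting.
\<close>
definition prim_rec :: "nat \<Rightarrow> (nat list \<Rightarrow> nat) \<Rightarrow> bool" where
  "prim_rec n f \<longleftrightarrow> (\<exists>F. primrec_fun n F \<and> (\<forall>xs. length xs = n \<longrightarrow> f xs = F xs))"

lemma prim_recI: "primrec_fun n f \<Longrightarrow> prim_rec n f"
  unfolding prim_rec_def by blast

lemma prim_rec_cong:
  assumes "prim_rec n f" "\<And>xs. length xs = n \<Longrightarrow> g xs = f xs"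
  shows "prim_rec n g"
  using assms unfolding prim_rec_def by metis

lemma prim_rec_nth: "i < n \<Longrightarrow> prim_rec n (\<lambda>xs. xs ! i)"
  by (intro prim_recI primrec_fun.proj)

lemma prim_rec_compose:
  assumes f: "prim_rec (length gs) f" and gs: "\<forall>g \<in> set gs. prim_rec n g"
  shows "prim_rec n (\<lambda>xs. f (map (\<lambda>g. g xs) gs))"
proof -
  obtain F where F: "primrec_fun (length gs) F" "\<And>ys. length ys = length gs \<Longrightarrow> f ys = F ys"
    using f unfolding prim_rec_def by blast
  obtain G where G: "\<And>g. g \<in> set gs \<Longrightarrow>
      primrec_fun n (G g) \<and> (\<forall>xs. length xs = n \<longrightarrow> g xs = G g xs)"
    using gs unfolding prim_rec_def by metis
  have "primrec_fun n (\<lambda>xs. F (map (\<lambda>g. g xs) (map G gs)))"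
    using F G by (intro primrec_fun.comp) auto
  moreover have "f (map (\<lambda>g. g xs) gs) = F (map (\<lambda>g. g xs) (map G gs))" if "length xs = n" for xs
    using that F(2) G by (auto simp: o_def intro!: arg_cong[of _ _ F])
  ultimately show ?thesis
    unfolding prim_rec_def by blast
qed

lemma prim_rec_compose1: "prim_rec 1 f \<Longrightarrow> prim_rec n g \<Longrightarrow> prim_rec n (\<lambda>xs. f [g xs])"
  using prim_rec_compose[of "[g]" f n] by simp

lemma prim_rec_compose2:
  "prim_rec 2 f \<Longrightarrow> prim_rec n g \<Longrightarrow> prim_rec n h \<Longrightarrow> prim_rec n (\<lambda>xs. f [g xs, h xs])"
  using prim_rec_compose[of "[g, h]" f n] by (simp add: numeral_2_eq_2)

lemma prim_rec_drop:
  assumes "prim_rec n f"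
  shows "prim_rec (k + n) (\<lambda>xs. f (drop k xs))"
proof -
  let ?gs = "map (\<lambda>i xs. xs ! (k + i)) [0..<n]"
  have "prim_rec (k + n) (\<lambda>xs. f (map (\<lambda>g. g xs) ?gs))"
    using assms by (intro prim_rec_compose) (auto intro: prim_rec_nth)
  moreover have "drop k xs = map (\<lambda>g. g xs) ?gs" if "length xs = k + n" for xs :: "nat list"
    using that by (intro nth_equalityI) auto
  ultimately show ?thesis
    by (elim prim_rec_cong) simp
qed

lemma prim_rec_drop2: "prim_rec n f \<Longrightarrow> prim_rec (Suc (Suc n)) (\<lambda>xs. f (drop 2 xs))"
  using prim_rec_drop[of n f 2] by simp

lemma prim_rec_Suc: "prim_rec n f \<Longrightarrow> prim_rec n (\<lambda>xs. Suc (f xs))"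
  using prim_rec_compose1[OF prim_recI[OF primrec_fun.succ], of n f] by simp

lemma prim_rec_const: "prim_rec n (\<lambda>_. c)"
  by (induction c) (auto intro: prim_recI primrec_fun.zero prim_rec_Suc)

text \<open>
  The recursion scheme with an arbitrary recursion argument \<open>b xs\<close>: recursion on the head of a
  list of length \<open>n + 1\<close>, with all of \<open>xs\<close> as parameters.
\<close>
lemma prim_rec_rec_nat:
  assumes a: "prim_rec n a" and g: "prim_rec (Suc (Suc n)) (\<lambda>ys. g (ys ! 0) (ys ! 1) (drop 2 ys))"
    and b: "prim_rec n b"
  shows "prim_rec n (\<lambda>xs. rec_nat (a xs) (\<lambda>y r. g y r xs) (b xs))"
proof -
  obtain A where A: "primrec_fun n A" "\<And>xs. length xs = n \<Longrightarrow> a xs = A xs"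
    using a unfolding prim_rec_def by blast
  obtain G where G: "primrec_fun (Suc (Suc n)) G"
    "\<And>ys. length ys = Suc (Suc n) \<Longrightarrow> g (ys ! 0) (ys ! 1) (drop 2 ys) = G ys"
    using g unfolding prim_rec_def by blast
  have G_Cons: "g y r xs = G (y # r # xs)" if "length xs = n" for y r xs
    using G(2)[of "y # r # xs"] that by simp
  let ?rec = "\<lambda>xs. rec_nat (A (tl xs)) (\<lambda>y r. G (y # r # tl xs)) (hd xs)"
  let ?gs = "b # map (\<lambda>i xs. xs ! i) [0..<n]"
  have "prim_rec (Suc n) ?rec"
    using A G by (intro prim_recI primrec_fun.prec)
  then have "prim_rec n (\<lambda>xs. ?rec (map (\<lambda>g. g xs) ?gs))"
    using b by (intro prim_rec_compose) (auto intro: prim_rec_nth)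
  moreover have "?rec (map (\<lambda>g. g xs) ?gs) = rec_nat (a xs) (\<lambda>y r. g y r xs) (b xs)"
    if "length xs = n" for xs
  proof -
    have "map (\<lambda>g. g xs) (map (\<lambda>i xs. xs ! i) [0..<n]) = xs"
      using that by (intro nth_equalityI) auto
    then show ?thesis
      using that A(2) G_Cons by simp
  qed
  ultimately show ?thesis
    by (elim prim_rec_cong) simp
qed

lemma prim_rec_if:
  assumes "prim_rec n (\<lambda>xs. of_bool (P xs))" "prim_rec n a" "prim_rec n b"
  shows "prim_rec n (\<lambda>xs. if P xs then a xs else b xs)"
proof -
  have "prim_rec n (\<lambda>xs. rec_nat (b xs) (\<lambda>y r. a xs) (of_bool (P xs)))"
    using assms by (intro prim_rec_rec_nat prim_rec_drop2)
  then show ?thesis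
    by (elim prim_rec_cong) auto
qed

lemma prim_rec_diff:
  assumes "prim_rec n a" "prim_rec n b"
  shows "prim_rec n (\<lambda>xs. a xs - b xs)"
proof -
  have pred: "prim_rec n (\<lambda>xs. c xs - 1)" if "prim_rec n c" for n c
  proof -
    have "prim_rec n (\<lambda>xs. rec_nat 0 (\<lambda>y r. y) (c xs))"
      using that by (intro prim_rec_rec_nat prim_rec_nth prim_rec_const) simp_all
    moreover have "rec_nat 0 (\<lambda>y r. y) k = k - 1" for k :: nat
      by (cases k) auto
    ultimately show ?thesis
      by simp
  qed
  have "prim_rec n (\<lambda>xs. rec_nat (a xs) (\<lambda>y r. r - 1) (b xs))"
    using assms by (intro prim_rec_rec_nat pred prim_rec_nth) simp_all
  moreover have "rec_nat x (\<lambda>y r. r - 1) k = x - k" for x k :: nat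
    by (induction k) auto
  ultimately show ?thesis
    by simp
qed

lemma prim_rec_le:
  assumes "prim_rec n a" "prim_rec n b"
  shows "prim_rec n (\<lambda>xs. of_bool (a xs \<le> b xs))"
proof -
  have "prim_rec n (\<lambda>xs. 1 - (a xs - b xs))"
    using assms by (intro prim_rec_diff prim_rec_const)
  then show ?thesis
    by (elim prim_rec_cong) auto
qed

lemma prim_rec_max: "prim_rec n a \<Longrightarrow> prim_rec n b \<Longrightarrow> prim_rec n (\<lambda>xs. max (a xs) (b xs))"
  unfolding max_def by (intro prim_rec_if prim_rec_le)

lemma prim_rec_min: "prim_rec n a \<Longrightarrow> prim_rec n b \<Longrightarrow> prim_rec n (\<lambda>xs. min (a xs) (b xs))"
  unfolding min_def by (intro prim_rec_if prim_rec_le)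

lemma prim_rec_eq:
  assumes "prim_rec n a" "prim_rec n b"
  shows "prim_rec n (\<lambda>xs. of_bool (a xs = b xs))"
proof -
  have "prim_rec n (\<lambda>xs. if a xs \<le> b xs then of_bool (b xs \<le> a xs) else 0)"
    using assms by (intro prim_rec_if prim_rec_le prim_rec_const)
  then show ?thesis
    by (elim prim_rec_cong) auto
qed

lemma prim_rec1_iff: "prim_rec1 f \<longleftrightarrow> prim_rec 1 (\<lambda>xs. f (xs ! 0))"
proof
  assume "prim_rec1 f"
  then show "prim_rec 1 (\<lambda>xs. f (xs ! 0))"
    unfolding prim_rec1_def prim_rec_def by (auto simp: length_Suc_conv)
next
  assume "prim_rec 1 (\<lambda>xs. f (xs ! 0))"
  then obtain F where F: "primrec_fun 1 F" "\<And>xs. length xs = 1 \<Longrightarrow> f (xs ! 0) = F xs"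
    unfolding prim_rec_def by blast
  have "f x = F [x]" for x
    using F(2)[of "[x]"] by simp
  with F(1) show "prim_rec1 f"
    unfolding prim_rec1_def by blast
qed

lemma prim_rec1_compose: "prim_rec1 f \<Longrightarrow> prim_rec n g \<Longrightarrow> prim_rec n (\<lambda>xs. f (g xs))"
  using prim_rec_compose1[of "\<lambda>xs. f (xs ! 0)" n g] by (simp add: prim_rec1_iff)

lemma prim_rec_rel_iff:
  "prim_rec_rel R \<longleftrightarrow> prim_rec 2 (\<lambda>xs. of_bool ((xs ! 0, xs ! 1) \<in> R))"
proof
  assume "prim_rec_rel R"
  then show "prim_rec 2 (\<lambda>xs. of_bool ((xs ! 0, xs ! 1) \<in> R))"
    unfolding prim_rec_rel_def prim_rec_def by (auto simp: length_Suc_conv numeral_2_eq_2)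
next
  assume "prim_rec 2 (\<lambda>xs. of_bool ((xs ! 0, xs ! 1) \<in> R))"
  then obtain F where F: "primrec_fun 2 F"
    "\<And>xs. length xs = 2 \<Longrightarrow> of_bool ((xs ! 0, xs ! 1) \<in> R) = F xs"
    unfolding prim_rec_def by blast
  have "F [x, y] = (if (x, y) \<in> R then 1 else 0)" for x y
    using F(2)[of "[x, y]"] by (simp add: of_bool_def)
  with F(1) show "prim_rec_rel R"
    unfolding prim_rec_rel_def by blast
qed

text \<open>
  Minimisation is primitive recursive as soon as a primitive recursive bound is known. The value
  \<open>s b\<close> of the recursion is the least witness if there is one up to \<open>b\<close>, and \<open>b\<close> otherwise; testing
  \<open>s b\<close> tells the two cases apart.
\<close>
lemma prim_rec1_Least:
  assumes P: "prim_rec 2 (\<lambda>xs. of_bool (P (xs ! 0) (xs ! 1)))" and h: "prim_rec1 h"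
    and bound: "\<And>x. \<exists>z \<le> h x. P z x"
  shows "prim_rec1 (\<lambda>x. LEAST z. P z x)"
proof -
  define s where "s x b = rec_nat 0 (\<lambda>y r. if P r x then r else Suc y) b" for x b
  have "prim_rec 1 (\<lambda>xs. s (xs ! 0) (h (xs ! 0)))"
    unfolding s_def
  proof (intro prim_rec_rec_nat prim_rec_const)
    show "prim_rec 1 (\<lambda>xs. h (xs ! 0))"
      using h by (simp add: prim_rec1_iff)
    have "prim_rec 3 (\<lambda>ys. of_bool (P (ys ! 1) (ys ! 2)))"
      using prim_rec_compose2[OF P, of 3 "\<lambda>ys. ys ! 1" "\<lambda>ys. ys ! 2"]
      by (simp add: prim_rec_nth)
    then have "prim_rec 3 (\<lambda>ys. if P (ys ! 1) (ys ! 2) then ys ! 1 else Suc (ys ! 0))"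
      by (intro prim_rec_if prim_rec_Suc prim_rec_nth) simp_all
    then have "prim_rec 3 (\<lambda>ys. if P (ys ! 1) (drop 2 ys ! 0) then ys ! 1 else Suc (ys ! 0))"
      by (rule prim_rec_cong) simp
    moreover have "3 = Suc (Suc 1)"
      by simp
    ultimately show "prim_rec (Suc (Suc 1))
        (\<lambda>ys. if P (ys ! 1) (drop 2 ys ! 0) then ys ! 1 else Suc (ys ! 0))"
      by metis
  qed
  moreover have "s x (h x) = (LEAST z. P z x)" for x
  proof -
    have "s x b \<le> b \<and> (\<forall>z < s x b. \<not> P z x) \<and> (P (s x b) x \<or> s x b = b)" for b
      by (induction b) (auto simp: s_def less_Suc_eq)
    then have "P (s x (h x)) x" "\<And>z. P z x \<Longrightarrow> s x (h x) \<le> z"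
      using bound[of x] by (metis le_less_trans nat_less_le not_less)+
    then show ?thesis
      by (rule Least_equality[symmetric])
  qed
  ultimately show ?thesis
    by (simp add: prim_rec1_iff)
qed

lemma prim_rec1_running_Max:
  assumes "prim_rec1 f"
  shows "prim_rec1 (\<lambda>x. Max (f ` {..x}))"
proof -
  have "prim_rec 1 (\<lambda>xs. rec_nat (f 0) (\<lambda>y r. max (f (Suc y)) r) (xs ! 0))"
    using assms
    by (intro prim_rec_rec_nat prim_rec_max prim_rec1_compose[of f] prim_rec_Suc prim_rec_nth
        prim_rec_const) simp_all
  moreover have "rec_nat (f 0) (\<lambda>y r. max (f (Suc y)) r) x = Max (f ` {..x})" for x
    by (induction x) (auto simp: atMost_Suc)
  ultimately show ?thesis
    by (simp add: prim_rec1_iff)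
qed

section \<open>Counting classes\<close>

definition class_count :: "(nat \<times> nat) set \<Rightarrow> nat \<Rightarrow> nat" where
  "class_count R x = card ((\<lambda>y. R `` {y}) ` {..x})"

lemma class_count_mono: "x \<le> y \<Longrightarrow> class_count R x \<le> class_count R y"
  unfolding class_count_def by (intro card_mono) auto

lemma class_count_0: "class_count R 0 = 1"
  by (simp add: class_count_def)

lemma class_count_Suc:
  assumes "equiv UNIV R"
  shows "class_count R (Suc x) = class_count R x + (if \<exists>y \<le> x. (y, Suc x) \<in> R then 0 else 1)"
proof -
  have "(\<exists>y \<le> x. (y, Suc x) \<in> R) \<longleftrightarrow> R `` {Suc x} \<in> (\<lambda>y. R `` {y}) ` {..x}"
    using equiv_class_eq_iff[OF assms] by auto
  then show ?thesis
    by (auto simp: class_count_def atMost_Suc card_insert_if)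
qed

lemma infinite_classes_iff:
  "infinite (UNIV // R) \<longleftrightarrow> (\<forall>n. \<exists>x. n \<le> class_count R x)"
proof
  assume inf: "infinite (UNIV // R)"
  show "\<forall>n. \<exists>x. n \<le> class_count R x"
  proof
    fix n
    obtain C where C: "C \<subseteq> UNIV // R" "finite C" "card C = n"
      using infinite_arbitrarily_large[OF inf] by blast
    have "C \<subseteq> range (\<lambda>y. R `` {y})"
      using C(1) by (auto simp: quotient_def)
    then obtain A where A: "finite A" "C = (\<lambda>y. R `` {y}) ` A"
      using finite_subset_image[OF C(2)] by metis
    have "A \<subseteq> {..Max A}"
      using A(1) by auto
    then have "C \<subseteq> (\<lambda>y. R `` {y}) ` {..Max A}"
      unfolding A(2) by (rule image_mono)
    then have "n \<le> class_count R (Max A)"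
      using C(3) unfolding class_count_def by (auto intro: card_mono)
    then show "\<exists>x. n \<le> class_count R x" ..
  qed
next
  assume unbounded: "\<forall>n. \<exists>x. n \<le> class_count R x"
  show "infinite (UNIV // R)"
  proof
    assume "finite (UNIV // R)"
    then have "class_count R x \<le> card (UNIV // R)" for x
      unfolding class_count_def by (intro card_mono) (auto simp: quotient_def)
    with unbounded show False
      by (meson not_less_eq_eq)
  qed
qed

text \<open>
  The count strictly increases whenever a new class appears, so it tells the first elements of
  distinct classes apart.
\<close>
lemma class_count_inj_on_new:
  assumes R: "equiv UNIV R" and x: "\<And>z. z < x \<Longrightarrow> (z, x) \<notin> R" and y: "\<And>z. z < y \<Longrightarrow> (z, y) \<notin> R"
    and eq: "class_count R x = class_count R y"
  shows "x = y"
proof -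
  have "class_count R x < class_count R y"
    if "x < y" "\<And>z. z < y \<Longrightarrow> (z, y) \<notin> R" for x y
  proof -
    obtain w where w: "y = Suc w"
      using \<open>x < y\<close> by (cases y) auto
    have "class_count R x \<le> class_count R w"
      using that(1) w by (intro class_count_mono) simp
    also have "\<dots> < class_count R y"
      using that(2) w class_count_Suc[OF R, of w] by (auto simp: less_Suc_eq_le)
    finally show ?thesis .
  qed
  from this[of x y] this[of y x] x y eq show ?thesis
    by (cases x y rule: linorder_cases) auto
qed

text \<open>The first element of a class; \<open>class_count R (leader R x)\<close> is then the index of the class of \<open>x\<close>.\<close>
definition leader :: "(nat \<times> nat) set \<Rightarrow> nat \<Rightarrow> nat" where
  "leader R x = (LEAST z. (z, x) \<in> R)"

lemma leader_related:
  assumes "equiv UNIV R"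
  shows "(leader R x, x) \<in> R"
  unfolding leader_def using equiv_class_self[OF assms, of x]
  by (intro LeastI[of "\<lambda>z. (z, x) \<in> R" x]) simp

lemma leader_le: "equiv UNIV R \<Longrightarrow> leader R x \<le> x"
  unfolding leader_def using equiv_class_self[of UNIV R x] by (intro Least_le) simp

lemma leader_new:
  assumes R: "equiv UNIV R" and z: "z < leader R x"
  shows "(z, leader R x) \<notin> R"
proof
  assume "(z, leader R x) \<in> R"
  then have "(z, x) \<in> R"
    using leader_related[OF R] R by (meson equiv_def transD)
  then show False
    using z not_less_Least unfolding leader_def by blast
qed

lemma leader_eq_iff:
  assumes R: "equiv UNIV R"
  shows "leader R x = leader R y \<longleftrightarrow> (x, y) \<in> R"
proof
  have sym: "(b, a) \<in> R" if "(a, b) \<in> R" for a b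
    using R that unfolding equiv_def by (blast dest: symD)
  have trans: "(a, c) \<in> R" if "(a, b) \<in> R" "(b, c) \<in> R" for a b c
    using R that unfolding equiv_def by (blast dest: transD)
  show "(x, y) \<in> R" if eq: "leader R x = leader R y"
  proof (rule trans)
    show "(x, leader R x) \<in> R"
      using leader_related[OF R] by (rule sym)
    show "(leader R x, y) \<in> R"
      unfolding eq using R by (rule leader_related)
  qed
  show "leader R x = leader R y" if xy: "(x, y) \<in> R"
  proof -
    have "(z, x) \<in> R \<longleftrightarrow> (z, y) \<in> R" for z
      using trans[of z x y] trans[of z y x] xy sym[OF xy] by blast
    then show ?thesis
      by (simp add: leader_def)
  qed
qed

lemma prim_rec1_leader:
  assumes "equiv UNIV R" "prim_rec_rel R"
  shows "prim_rec1 (leader R)"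
proof -
  have "prim_rec1 (\<lambda>x. LEAST z. (z, x) \<in> R)"
  proof (rule prim_rec1_Least)
    show "prim_rec 2 (\<lambda>xs. of_bool ((xs ! 0, xs ! 1) \<in> R))"
      using assms(2) by (simp add: prim_rec_rel_iff)
    show "prim_rec1 (\<lambda>x. x)"
      by (simp add: prim_rec1_iff prim_rec_nth)
    show "\<exists>z \<le> x. (z, x) \<in> R" for x
      using assms(1) by (auto simp: equiv_def refl_on_def)
  qed
  then show ?thesis
    by (simp add: leader_def[abs_def])
qed

lemma prim_rec1_class_count:
  assumes R: "equiv UNIV R" "prim_rec_rel R"
  shows "prim_rec1 (class_count R)"
proof -
  let ?step = "\<lambda>y r. if leader R (Suc y) = Suc y then Suc r else r"
  have "prim_rec 1 (\<lambda>xs. rec_nat 1 ?step (xs ! 0))"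
    by (intro prim_rec_rec_nat prim_rec_if prim_rec_eq prim_rec_Suc prim_rec_nth prim_rec_const
        prim_rec1_compose[OF prim_rec1_leader[OF R]]) simp_all
  moreover have "rec_nat 1 ?step x = class_count R x" for x
  proof (induction x)
    case 0
    then show ?case by (simp add: class_count_0)
  next
    case (Suc x)
    have "leader R (Suc x) = Suc x \<longleftrightarrow> \<not> (\<exists>y \<le> x. (y, Suc x) \<in> R)"
      using leader_new[OF R(1), of _ "Suc x"] leader_le[OF R(1), of "Suc x"]
        leader_related[OF R(1), of "Suc x"]
      by (metis le_SucE less_Suc_eq_le)
    with Suc show ?case
      by (simp add: class_count_Suc[OF R(1)])
  qed
  ultimately show ?thesis
    by (simp add: prim_rec1_iff)
qed

section \<open>Reducibility in terms of class counts\<close>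

lemma class_count_le_of_reduction:
  assumes f: "\<And>x y. (x, y) \<in> R \<longleftrightarrow> (f x, f y) \<in> S"
  shows "class_count R x \<le> class_count S (Max (f ` {..x}))"
proof -
  \<comment> \<open>Mapping the class of \<open>y\<close> to the class of \<open>f y\<close> is injective; it is easier to count backwards,
    through the map that sends an \<open>S\<close>-class to its preimage under \<open>f\<close>.\<close>
  have preimage: "R `` {y} = f -` (S `` {f y})" for y
    using f by auto
  have "(\<lambda>y. R `` {y}) ` {..x} \<subseteq> (\<lambda>C. f -` C) ` ((\<lambda>y. S `` {y}) ` {..Max (f ` {..x})})"
    by (auto simp: preimage)
  then have "class_count R x \<le> card ((\<lambda>C. f -` C) ` ((\<lambda>y. S `` {y}) ` {..Max (f ` {..x})}))"
    unfolding class_count_def by (intro card_mono) auto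
  also have "\<dots> \<le> class_count S (Max (f ` {..x}))"
    unfolding class_count_def by (intro card_image_le) auto
  finally show ?thesis .
qed

text \<open>
  The search for the first \<open>z\<close> with \<open>class_count S z \<ge> k\<close> hits \<open>k\<close> exactly, since counts grow by at
  most 1, and it stops at the first element of a class. Distinct indices therefore lead to
  \<open>S\<close>-inequivalent elements.
\<close>
lemma class_count_Least:
  assumes S: "equiv UNIV S" and k: "1 \<le> k" "k \<le> class_count S b"
  defines "z \<equiv> LEAST z. k \<le> class_count S z"
  shows "class_count S z = k" "\<And>y. y < z \<Longrightarrow> (y, z) \<notin> S"
proof -
  have ge: "k \<le> class_count S z"
    unfolding z_def using k(2) by (rule LeastI)
  have less: "class_count S y < k" if "y < z" for y
    using not_less_Least[of y "\<lambda>z. k \<le> class_count S z"] that by (simp add: z_def)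
  have "class_count S z = k \<and> (\<forall>y < z. (y, z) \<notin> S)"
  proof (cases z)
    case 0
    then show ?thesis using ge k(1) by (simp add: class_count_0)
  next
    case (Suc w)
    then have "class_count S w < k"
      by (intro less) simp
    with ge Suc show ?thesis
      using class_count_Suc[OF S, of w] by (auto split: if_splits simp: less_Suc_eq_le)
  qed
  then show "class_count S z = k" "\<And>y. y < z \<Longrightarrow> (y, z) \<notin> S"
    by auto
qed

theorem pr_reducible_iff_class_count:
  assumes R: "R \<in> punctual_eqrels" and S: "S \<in> punctual_eqrels"
  shows "R \<le>pr S \<longleftrightarrow> (\<exists>h. prim_rec1 h \<and> (\<forall>x. class_count R x \<le> class_count S (h x)))"
proof
  have eR: "equiv UNIV R" "prim_rec_rel R" and eS: "equiv UNIV S" "prim_rec_rel S"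
    using R S by (auto simp: punctual_eqrels_def)
  show "\<exists>h. prim_rec1 h \<and> (\<forall>x. class_count R x \<le> class_count S (h x))" if red: "R \<le>pr S"
  proof -
    obtain f where f: "prim_rec1 f" "\<And>x y. (x, y) \<in> R \<longleftrightarrow> (f x, f y) \<in> S"
      using red unfolding pr_reducible_def by blast
    show ?thesis
      using class_count_le_of_reduction[of R f S] f prim_rec1_running_Max[OF f(1)] by blast
  qed
  show "R \<le>pr S" if bounded: "\<exists>h. prim_rec1 h \<and> (\<forall>x. class_count R x \<le> class_count S (h x))"
  proof -
    obtain h where h: "prim_rec1 h" "\<And>x. class_count R x \<le> class_count S (h x)"
      using bounded by blast
    define k where "k x = class_count R (leader R x)" for x
    define f where "f x = (LEAST z. k x \<le> class_count S z)" for x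
    have k: "1 \<le> k x" "k x \<le> class_count S (h (leader R x))" for x
      using class_count_mono[of 0 "leader R x" R] h(2) by (auto simp: k_def class_count_0)
    have f_hits: "class_count S (f x) = k x" "\<And>y. y < f x \<Longrightarrow> (y, f x) \<notin> S" for x
      using class_count_Least[OF _ k[of x]] eS unfolding f_def by blast+
    have pr_leader: "prim_rec1 (leader R)"
      using eR by (intro prim_rec1_leader) auto
    have "prim_rec1 f"
      unfolding f_def
    proof (rule prim_rec1_Least)
      show "prim_rec 2 (\<lambda>xs. of_bool (k (xs ! 1) \<le> class_count S (xs ! 0)))"
        unfolding k_def using eR eS
        by (intro prim_rec_le prim_rec1_compose[OF prim_rec1_class_count]
            prim_rec1_compose[OF pr_leader] prim_rec_nth) auto
      show "prim_rec1 (\<lambda>x. h (leader R x))"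
        using prim_rec1_compose[OF h(1)] pr_leader by (simp add: prim_rec1_iff)
      show "\<exists>z \<le> h (leader R x). k x \<le> class_count S z" for x
        using k(2) by blast
    qed
    moreover have "(x, y) \<in> R \<longleftrightarrow> (f x, f y) \<in> S" for x y
    proof -
      have "(x, y) \<in> R \<longleftrightarrow> leader R x = leader R y"
        using eR leader_eq_iff by blast
      also have "\<dots> \<longleftrightarrow> k x = k y"
        using class_count_inj_on_new[of R "leader R x" "leader R y"] leader_new[of R] eR
        unfolding k_def by metis
      also have "\<dots> \<longleftrightarrow> f x = f y"
      proof
        show "f x = f y" if "k x = k y"
          using that by (simp add: f_def)
        show "k x = k y" if "f x = f y"
          using that f_hits(1)[of x] f_hits(1)[of y] by simp
      qed
      also have "\<dots> \<longleftrightarrow> (f x, f y) \<in> S"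
      proof
        show "(f x, f y) \<in> S" if "f x = f y"
          using that eS by (auto simp: equiv_def refl_on_def)
        show "f x = f y" if "(f x, f y) \<in> S"
        proof -
          have "(f y, f x) \<in> S"
            using that eS by (auto simp: equiv_def elim: symE)
          with that f_hits(2) show ?thesis
            by (cases "f x" "f y" rule: linorder_cases) auto
        qed
      qed
      finally show ?thesis .
    qed
    ultimately show ?thesis
      unfolding pr_reducible_def by blast
  qed
qed

section \<open>Counting functions\<close>

text \<open>These are exactly the functions \<open>class_count R\<close> for punctual \<open>R\<close>.\<close>
definition counting_fun :: "(nat \<Rightarrow> nat) \<Rightarrow> bool" where
  "counting_fun m \<longleftrightarrow> prim_rec1 m \<and> mono m \<and> m 0 = 1 \<and> (\<forall>x. m (Suc x) \<le> Suc (m x)) \<and>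
    (\<forall>n. \<exists>x. n \<le> m x)"

lemma counting_fun_class_count: "R \<in> punctual_eqrels \<Longrightarrow> counting_fun (class_count R)"
  by (auto simp: counting_fun_def punctual_eqrels_def infinite_classes_iff class_count_0
      class_count_Suc prim_rec1_class_count class_count_mono intro: monoI)

text \<open>
  The kernel of a counting function \<open>m\<close> has intervals as classes, and a new interval begins exactly
  where \<open>m\<close> increases by 1; so the kernel has counting function \<open>m\<close>.
\<close>
lemma counting_fun_realised:
  assumes m: "counting_fun m"
  obtains R where "R \<in> punctual_eqrels" "class_count R = m"
proof
  let ?R = "{(x, y). m x = m y}"
  have equiv: "equiv UNIV ?R"
    by (auto simp: equiv_def refl_on_def sym_def trans_def)
  show count: "class_count ?R = m"
  proof
    show "class_count ?R x = m x" for x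
    proof (induction x)
      case 0
      then show ?case using m by (simp add: class_count_0 counting_fun_def)
    next
      case (Suc x)
      have mono: "y \<le> z \<Longrightarrow> m y \<le> m z" for y z
        using m by (auto simp: counting_fun_def mono_def)
      have step: "m (Suc x) = m x \<or> m (Suc x) = Suc (m x)"
        using m mono[of x "Suc x"] unfolding counting_fun_def
        by (metis le_Suc_eq le_antisym lessI less_imp_le)
      have "(\<exists>y \<le> x. m y = m (Suc x)) \<longleftrightarrow> m x = m (Suc x)"
        using mono[of _ x] mono[of x "Suc x"] by (metis le_antisym le_refl le_SucI)
      with step Suc show ?case
        by (auto simp: class_count_Suc[OF equiv])
    qed
  qed
  have "prim_rec_rel ?R"
  proof -
    have "prim_rec1 m"
      using m by (simp add: counting_fun_def)
    then have "prim_rec 2 (\<lambda>xs. of_bool (m (xs ! 0) = m (xs ! 1)))"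
      by (intro prim_rec_eq prim_rec1_compose[of m] prim_rec_nth) simp_all
    then show ?thesis
      by (simp add: prim_rec_rel_iff)
  qed
  moreover have "infinite (UNIV // ?R)"
    using m unfolding infinite_classes_iff count by (simp add: counting_fun_def)
  ultimately show "?R \<in> punctual_eqrels"
    using equiv by (simp add: punctual_eqrels_def)
qed

lemma counting_fun_max:
  assumes "counting_fun m" "counting_fun n"
  shows "counting_fun (\<lambda>x. max (m x) (n x))"
proof -
  have "max (m (Suc x)) (n (Suc x)) \<le> Suc (max (m x) (n x))" for x
  proof -
    have "m (Suc x) \<le> Suc (m x)" "n (Suc x) \<le> Suc (n x)"
      using assms by (auto simp: counting_fun_def)
    then show ?thesis by linarith
  qed
  then show ?thesis
    using assms unfolding counting_fun_def prim_rec1_iff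
    by (auto intro!: prim_rec_max monoI max.mono intro: monoD simp: le_max_iff_disj)
qed

lemma counting_fun_min:
  assumes "counting_fun m" "counting_fun n"
  shows "counting_fun (\<lambda>x. min (m x) (n x))"
proof -
  have "\<exists>x. k \<le> m x \<and> k \<le> n x" for k
  proof -
    obtain x y where "k \<le> m x" "k \<le> n y"
      using assms unfolding counting_fun_def by metis
    then have "k \<le> m (max x y)" "k \<le> n (max x y)"
      using assms unfolding counting_fun_def
      by (meson max.cobounded1 max.cobounded2 monoD order_trans)+
    then show ?thesis by blast
  qed
  moreover have "min (m (Suc x)) (n (Suc x)) \<le> Suc (min (m x) (n x))" for x
  proof -
    have "m (Suc x) \<le> Suc (m x)" "n (Suc x) \<le> Suc (n x)"
      using assms by (auto simp: counting_fun_def)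
    then show ?thesis by linarith
  qed
  ultimately show ?thesis
    using assms unfolding counting_fun_def prim_rec1_iff
    by (auto intro!: prim_rec_min monoI min.mono intro: monoD)
qed

lemma pr_reducible_if_class_count_le:
  assumes "R \<in> punctual_eqrels" "S \<in> punctual_eqrels" "\<And>x. class_count R x \<le> class_count S x"
  shows "R \<le>pr S"
  using assms pr_reducible_iff_class_count[of R S] prim_rec_nth[of 0 1]
  by (auto simp: prim_rec1_iff intro!: exI[of _ "\<lambda>x. x"])

text \<open>One bounding function serves both reductions, because class counts are monotone.\<close>
lemma common_bound:
  assumes "prim_rec1 g" "prim_rec1 h"
  shows "prim_rec1 (\<lambda>x. max (g x) (h x))"
    and "class_count R (g x) \<le> class_count R (max (g x) (h x))"
    and "class_count R (h x) \<le> class_count R (max (g x) (h x))"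
  using assms by (auto simp: prim_rec1_iff intro: prim_rec_max class_count_mono)

lemma punctual_sup_exists:
  assumes R: "R \<in> punctual_eqrels" and S: "S \<in> punctual_eqrels"
  obtains J where "J \<in> punctual_eqrels" "R \<le>pr J" "S \<le>pr J"
    "\<And>T. T \<in> punctual_eqrels \<Longrightarrow> R \<le>pr T \<Longrightarrow> S \<le>pr T \<Longrightarrow> J \<le>pr T"
proof -
  obtain J where J: "J \<in> punctual_eqrels"
    "class_count J = (\<lambda>x. max (class_count R x) (class_count S x))"
    using counting_fun_realised counting_fun_max counting_fun_class_count R S by metis
  have "J \<le>pr T" if T: "T \<in> punctual_eqrels" "R \<le>pr T" "S \<le>pr T" for T
  proof -
    obtain g h where gh: "prim_rec1 g" "\<And>x. class_count R x \<le> class_count T (g x)"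
      "prim_rec1 h" "\<And>x. class_count S x \<le> class_count T (h x)"
      using T R S pr_reducible_iff_class_count by metis
    have "class_count J x \<le> class_count T (max (g x) (h x))" for x
      using gh common_bound(2,3)[OF gh(1,3), of T x] J(2) by (metis max.bounded_iff order_trans)
    then show ?thesis
      using common_bound(1)[OF gh(1,3)] pr_reducible_iff_class_count[OF J(1) T(1)] by blast
  qed
  then show thesis
    using that[of J] J R S by (simp add: pr_reducible_if_class_count_le)
qed

lemma punctual_inf_exists:
  assumes R: "R \<in> punctual_eqrels" and S: "S \<in> punctual_eqrels"
  obtains M where "M \<in> punctual_eqrels" "M \<le>pr R" "M \<le>pr S"
    "\<And>T. T \<in> punctual_eqrels \<Longrightarrow> T \<le>pr R \<Longrightarrow> T \<le>pr S \<Longrightarrow> T \<le>pr M"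
proof -
  obtain M where M: "M \<in> punctual_eqrels"
    "class_count M = (\<lambda>x. min (class_count R x) (class_count S x))"
    using counting_fun_realised counting_fun_min counting_fun_class_count R S by metis
  have "T \<le>pr M" if T: "T \<in> punctual_eqrels" "T \<le>pr R" "T \<le>pr S" for T
  proof -
    obtain g h where gh: "prim_rec1 g" "\<And>x. class_count T x \<le> class_count R (g x)"
      "prim_rec1 h" "\<And>x. class_count T x \<le> class_count S (h x)"
      using T R S pr_reducible_iff_class_count by metis
    have "class_count T x \<le> class_count M (max (g x) (h x))" for x
      using gh common_bound(2)[OF gh(1,3), of R x] common_bound(3)[OF gh(1,3), of S x] M(2)
      by (metis min.bounded_iff order_trans)
    then show ?thesis
      using common_bound(1)[OF gh(1,3)] pr_reducible_iff_class_count[OF T(1) M(1)] by blast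
  qed
  then show thesis
    using that[of M] M R S by (simp add: pr_reducible_if_class_count_le)
qed

section \<open>Passing to degrees\<close>

lemma pr_reducible_refl: "R \<le>pr R"
  unfolding pr_reducible_def using prim_rec_nth[of 0 1]
  by (auto simp: prim_rec1_iff intro!: exI[of _ "\<lambda>x. x"])

lemma pr_reducible_trans:
  assumes "R \<le>pr S" "S \<le>pr T"
  shows "R \<le>pr T"
proof -
  obtain f g where fg: "prim_rec1 f" "\<And>x y. (x, y) \<in> R \<longleftrightarrow> (f x, f y) \<in> S"
    "prim_rec1 g" "\<And>x y. (x, y) \<in> S \<longleftrightarrow> (g x, g y) \<in> T"
    using assms unfolding pr_reducible_def by metis
  have "prim_rec1 (\<lambda>x. g (f x))"
    using prim_rec1_compose[OF fg(3)] fg(1) by (simp add: prim_rec1_iff)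
  then show ?thesis
    unfolding pr_reducible_def using fg by blast
qed

lemma equiv_pr_equiv: "equiv punctual_eqrels pr_equiv"
  by (auto simp: equiv_def pr_equiv_def refl_on_def sym_def trans_def pr_reducible_refl
      intro: pr_reducible_trans)

lemma carrier_PeqE:
  assumes "a \<in> carrier Peq"
  obtains R where "R \<in> punctual_eqrels" "a = pr_equiv `` {R}"
  using assms by (auto simp: Peq_def elim: quotientE)

lemma carrier_PeqI: "R \<in> punctual_eqrels \<Longrightarrow> pr_equiv `` {R} \<in> carrier Peq"
  by (simp add: Peq_def quotientI)

lemma le_Peq_iff:
  assumes "R \<in> punctual_eqrels" "S \<in> punctual_eqrels"
  shows "pr_equiv `` {R} \<sqsubseteq>\<^bsub>Peq\<^esub> pr_equiv `` {S} \<longleftrightarrow> R \<le>pr S"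
proof
  show "R \<le>pr S" if "pr_equiv `` {R} \<sqsubseteq>\<^bsub>Peq\<^esub> pr_equiv `` {S}"
    using that by (auto simp: Peq_def pr_equiv_def intro: pr_reducible_trans)
  have "R \<in> pr_equiv `` {R}" "S \<in> pr_equiv `` {S}"
    using assms equiv_class_self[OF equiv_pr_equiv] by blast+
  then show "pr_equiv `` {R} \<sqsubseteq>\<^bsub>Peq\<^esub> pr_equiv `` {S}" if "R \<le>pr S"
    using that by (auto simp: Peq_def)
qed

lemma partial_order_Peq: "partial_order Peq"
proof
  fix a b c
  show "a \<sqsubseteq>\<^bsub>Peq\<^esub> a" if "a \<in> carrier Peq"
    using that by (elim carrier_PeqE) (simp add: le_Peq_iff pr_reducible_refl)
  show "a .=\<^bsub>Peq\<^esub> b" if le: "a \<sqsubseteq>\<^bsub>Peq\<^esub> b" "b \<sqsubseteq>\<^bsub>Peq\<^esub> a"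
    and carrier: "a \<in> carrier Peq" "b \<in> carrier Peq"
  proof -
    obtain R S where RS: "R \<in> punctual_eqrels" "a = pr_equiv `` {R}"
      "S \<in> punctual_eqrels" "b = pr_equiv `` {S}"
      using carrier by (elim carrier_PeqE)
    with le have "R \<le>pr S" "S \<le>pr R"
      by (simp_all add: le_Peq_iff)
    with RS have "(R, S) \<in> pr_equiv"
      by (simp add: pr_equiv_def)
    with RS have "a = b"
      using equiv_class_eq[OF equiv_pr_equiv] by simp
    then show ?thesis
      by (simp add: Peq_def)
  qed
  show "a \<sqsubseteq>\<^bsub>Peq\<^esub> c" if "a \<sqsubseteq>\<^bsub>Peq\<^esub> b" "b \<sqsubseteq>\<^bsub>Peq\<^esub> c"
    "a \<in> carrier Peq" "b \<in> carrier Peq" "c \<in> carrier Peq"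
    using that by (elim carrier_PeqE) (auto simp: le_Peq_iff intro: pr_reducible_trans)
qed (auto simp: Peq_def)

lemma Peq_sup_exists:
  assumes "a \<in> carrier Peq" "b \<in> carrier Peq"
  shows "\<exists>s. is_lub Peq s {a, b}"
proof -
  obtain R S where RS: "R \<in> punctual_eqrels" "a = pr_equiv `` {R}"
    "S \<in> punctual_eqrels" "b = pr_equiv `` {S}"
    using assms by (elim carrier_PeqE)
  obtain J where J: "J \<in> punctual_eqrels" "R \<le>pr J" "S \<le>pr J"
    "\<And>T. T \<in> punctual_eqrels \<Longrightarrow> R \<le>pr T \<Longrightarrow> S \<le>pr T \<Longrightarrow> J \<le>pr T"
    using punctual_sup_exists[OF RS(1,3)] by metis
  have "is_lub Peq (pr_equiv `` {J}) {a, b}"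
    using RS J by (auto simp: least_def Upper_def le_Peq_iff carrier_PeqI elim!: carrier_PeqE)
  then show ?thesis ..
qed

lemma Peq_inf_exists:
  assumes "a \<in> carrier Peq" "b \<in> carrier Peq"
  shows "\<exists>s. is_glb Peq s {a, b}"
proof -
  obtain R S where RS: "R \<in> punctual_eqrels" "a = pr_equiv `` {R}"
    "S \<in> punctual_eqrels" "b = pr_equiv `` {S}"
    using assms by (elim carrier_PeqE)
  obtain M where M: "M \<in> punctual_eqrels" "M \<le>pr R" "M \<le>pr S"
    "\<And>T. T \<in> punctual_eqrels \<Longrightarrow> T \<le>pr R \<Longrightarrow> T \<le>pr S \<Longrightarrow> T \<le>pr M"
    using punctual_inf_exists[OF RS(1,3)] by metis
  have "is_glb Peq (pr_equiv `` {M}) {a, b}"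
    using RS M by (auto simp: greatest_def Lower_def le_Peq_iff carrier_PeqI elim!: carrier_PeqE)
  then show ?thesis ..
qed

theorem theorem5p3:
  shows "Lattice.lattice Peq"
proof -
  interpret partial_order Peq
    by (rule partial_order_Peq)
  show ?thesis
    by unfold_locales (auto intro: Peq_sup_exists Peq_inf_exists)
qed

end
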